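(* For every integer $n\ge 1$ and all real numbers $x,y$, $$D_{n}^{(s)}(x,y)= \sum_{m=0}^{[\frac{n-1}{2}]}\binom{n}{2m+1}(-1)^{m}y^{2m+1}D_{n-2m-1}(x).$$
   Context: The derangement polynomials $D_n(x)$ and the sine-derangement polynomials $D_n^{(s)}(x,y)$, $n\ge 0$, are defined by the generating functions (power series in $t$) $\displaystyle\frac{e^{-t}}{1-t}e^{xt}=\sum_{n=0}^{\infty}D_{n}(x)\frac{t^{n}}{n!}$ and $\displaystyle\frac{e^{-t}}{1-t}e^{xt}\sin(yt)=\sum_{n=0}^{\infty}D_{n}^{(s)}(x,y)\frac{t^{n}}{n!}$. $[a]$ denotes the greatest integer not exceeding $a$. *)

theory Defs
  imports Complex_Main "HOL-Computational_Algebra.Formal_Power_Series"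
begin

text \<open>
  The generating functions are read as formal power series in \<open>t\<close> over the reals, with
  \<open>fps_X\<close> for \<open>t\<close>, \<open>fps_exp c\<close> for the series of \<open>exp (c t)\<close> and \<open>fps_sin c\<close> for that
  of \<open>sin (c t)\<close>. They are exponential generating functions, so the \<open>n\<close>-th polynomial
  is \<open>n!\<close> times the \<open>n\<close>-th coefficient. The polynomials are represented by their
  values at real arguments.
\<close>

definition derangement_gf :: "real \<Rightarrow> real fps" where
  "derangement_gf x = fps_exp (-1) / (1 - fps_X) * fps_exp x"

definition derangement_poly :: "nat \<Rightarrow> real \<Rightarrow> real" where
  "derangement_poly n x = fact n * fps_nth (derangement_gf x) n"

definition sine_derangement_gf :: "real \<Rightarrow> real \<Rightarrow> real fps" where
  "sine_derangement_gf x y = fps_exp (-1) / (1 - fps_X) * fps_exp x * fps_sin y"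

definition sine_derangement_poly :: "nat \<Rightarrow> real \<Rightarrow> real \<Rightarrow> real" where
  "sine_derangement_poly n x y = fact n * fps_nth (sine_derangement_gf x y) n"

end

theory Submission
  imports Defs
begin

text \<open>
  Multiplying the generating function of the derangement polynomials by that of \<open>sin (y t)\<close>
  gives the one of the sine-derangement polynomials. For exponential generating functions,
  the Cauchy product is the binomial convolution of the coefficients after both are scaled
  by factorials. The \<open>k\<close>-th scaled coefficient of \<open>sin (y t)\<close> vanishes for even \<open>k\<close> and is
  \<open>(-1) ^ m * y ^ (2 * m + 1)\<close> for \<open>k = 2 * m + 1\<close>, so only the odd terms of the
  convolution survive.
\<close>

text \<open>
  Since \<open>n choose k = fact n / (fact k * fact (n - k))\<close>, the factorial in front of each
  term of the Cauchy product splits between the two coefficients, at the cost of a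
  binomial coefficient.
\<close>

lemma fact_times_fps_mult_nth:
  fixes f g :: "'a::field_char_0 fps"
  shows "fact n * fps_nth (f * g) n =
    (\<Sum>k = 0..n. of_nat (n choose k) * (fact k * fps_nth f k) *
      (fact (n - k) * fps_nth g (n - k)))"
  unfolding fps_mult_nth sum_distrib_left
  by (intro sum.cong refl) (simp add: binomial_fact)

text \<open>
  The largest \<open>m\<close> with \<open>2 * m + 1 \<le> n\<close> is \<open>(n - 1) div 2\<close>; for \<open>n = 0\<close> there is none, but
  truncated subtraction would still leave the term \<open>f 1\<close> on the right.
\<close>

lemma sum_odd_indices:
  fixes f :: "nat \<Rightarrow> 'a::comm_monoid_add"
  assumes "n \<ge> 1" and even_zero: "\<And>k. even k \<Longrightarrow> f k = 0"
  shows "sum f {0..n} = (\<Sum>m = 0..(n - 1) div 2. f (2 * m + 1))"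
proof -
  have "sum f {0..n} = sum f {k \<in> {0..n}. odd k}"
    by (rule sum.mono_neutral_right) (auto simp: even_zero)
  also have "\<dots> = (\<Sum>m = 0..(n - 1) div 2. f (2 * m + 1))"
    using \<open>n \<ge> 1\<close>
    by (intro sum.reindex_bij_witness[where i = "\<lambda>m. 2 * m + 1" and j = "\<lambda>k. k div 2"])
       (auto elim!: oddE)
  finally show ?thesis .
qed

theorem theorem16:
  fixes n :: nat and x y :: real
  assumes "n \<ge> 1"
  shows "sine_derangement_poly n x y =
    (\<Sum>m = 0..(n - 1) div 2.
      real (n choose (2 * m + 1)) * (-1) ^ m * y ^ (2 * m + 1) *
      derangement_poly (n - 2 * m - 1) x)"
proof -
  have "sine_derangement_gf x y = fps_sin y * derangement_gf x"
    by (simp add: sine_derangement_gf_def derangement_gf_def mult.commute)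
  hence "sine_derangement_poly n x y =
    (\<Sum>k = 0..n. real (n choose k) * (fact k * fps_nth (fps_sin y) k) *
      derangement_poly (n - k) x)"
    by (simp only: sine_derangement_poly_def derangement_poly_def fact_times_fps_mult_nth)
  also have "\<dots> = (\<Sum>m = 0..(n - 1) div 2.
      real (n choose (2 * m + 1)) *
      (fact (2 * m + 1) * fps_nth (fps_sin y) (2 * m + 1)) *
      derangement_poly (n - (2 * m + 1)) x)"
    by (rule sum_odd_indices[OF assms]) (simp add: fps_sin_def)
  also have "\<dots> = (\<Sum>m = 0..(n - 1) div 2.
      real (n choose (2 * m + 1)) * (-1) ^ m * y ^ (2 * m + 1) *
      derangement_poly (n - 2 * m - 1) x)"
    by (intro sum.cong refl) (simp add: fps_sin_def del: fact_Suc)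
  finally show ?thesis .
qed

end
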